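(* Let $p_1<p_2<\dots<p_N$ ($N\ge 3$) and $q_1,\dots,q_N$ be real numbers, let $I=[p_1,p_N]$, let $m\ge1$ be an integer, and let $\alpha_1,\dots,\alpha_{N-1}\in(-1,1)$. Let $g:I\to\mathbb{R}$ be the piecewise linear interpolant of the data and let $S_i(p)=a_ip+b_i$ be the affine map with $S_i(p_1)=p_i$, $S_i(p_N)=p_{i+1}$. Let $\psi:I\to\mathbb{R}$ be the Bernstein fractal interpolation function, i.e. the continuous function with $\psi(p_i)=q_i$ for all $i$ satisfying $$\psi(p)=\alpha_i\,\psi(S_i^{-1}(p))+g(p)-\alpha_iB_m(g,S_i^{-1}(p)),\qquad p\in[p_i,p_{i+1}],\ i=1,\dots,N-1.$$ Then the integral $M_1=\int_{p_1}^{p_N}\psi(p)\,dp$ is given by $$M_1=\frac{\displaystyle\sum_{i=1}^{N-1}a_i\int_{p_1}^{p_N}g(S_i(p))\,dp-\sum_{i=1}^{N-1}\alpha_ia_i\int_{p_1}^{p_N}B_m(g,p)\,dp}{\displaystyle 1-\sum_{i=1}^{N-1}\alpha_ia_i}.$$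
   Context: The piecewise linear interpolant $g$ is the continuous function on $I$ that is affine on each $[p_i,p_{i+1}]$ and satisfies $g(p_i)=q_i$ for all $i$. The $m$-th Bernstein polynomial of $g$ on $I$ is $$B_m(g,p)=\frac{1}{(p_N-p_1)^m}\sum_{v=0}^m\binom{m}{v}(p-p_1)^v(p_N-p)^{m-v}\,g\Bigl(p_1+\frac{v(p_N-p_1)}{m}\Bigr).$$ *)

theory Defs
  imports "HOL-Analysis.Analysis"
begin

text \<open>Data points are functions on \<open>nat\<close>, of which only the indices \<open>1, \<dots>, N\<close> matter.
  Functions on \<open>I = [p 1, p N]\<close> are total functions on the reals, of which only the values
  on \<open>I\<close> matter.\<close>

definition pl_interpolant ::
  "nat \<Rightarrow> (nat \<Rightarrow> real) \<Rightarrow> (nat \<Rightarrow> real) \<Rightarrow> (real \<Rightarrow> real) \<Rightarrow> bool" where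
  "pl_interpolant N p q g \<longleftrightarrow>
     continuous_on {p 1..p N} g \<and>
     (\<forall>i\<in>{1..N-1}. \<exists>c d. \<forall>x\<in>{p i..p (i+1)}. g x = c * x + d) \<and>
     (\<forall>i\<in>{1..N}. g (p i) = q i)"

definition bernstein_poly ::
  "nat \<Rightarrow> real \<Rightarrow> real \<Rightarrow> (real \<Rightarrow> real) \<Rightarrow> real \<Rightarrow> real" where
  "bernstein_poly m l u g x =
     1 / (u - l) ^ m *
     (\<Sum>v = 0..m. real (m choose v) * (x - l) ^ v * (u - x) ^ (m - v) *
        g (l + real v * (u - l) / real m))"

text \<open>\<open>S i\<close> is meant to be a bijective affine map of the real line, so \<open>inv (S i)\<close> is its genuine
  inverse, and it maps \<open>[p i, p (i+1)]\<close> onto \<open>[p 1, p N]\<close>.\<close>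

definition bernstein_fif ::
  "nat \<Rightarrow> (nat \<Rightarrow> real) \<Rightarrow> (nat \<Rightarrow> real) \<Rightarrow> (nat \<Rightarrow> real \<Rightarrow> real) \<Rightarrow> (nat \<Rightarrow> real) \<Rightarrow> nat \<Rightarrow>
   (real \<Rightarrow> real) \<Rightarrow> (real \<Rightarrow> real) \<Rightarrow> bool" where
  "bernstein_fif N p q S \<alpha> m g \<psi> \<longleftrightarrow>
     continuous_on {p 1..p N} \<psi> \<and>
     (\<forall>i\<in>{1..N}. \<psi> (p i) = q i) \<and>
     (\<forall>i\<in>{1..N-1}. \<forall>x\<in>{p i..p (i+1)}.
        \<psi> x = \<alpha> i * \<psi> (inv (S i) x) + g x
               - \<alpha> i * bernstein_poly m (p 1) (p N) g (inv (S i) x))"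

end

(* Substituting x = S i t on [p i, p (i+1)] in the self-referential equation expresses the integral
   of \<psi> over that piece through its integral over the whole interval. Summing over i gives a
   linear equation for the latter, which is solvable because the a i are positive with sum 1 and
   \<alpha> i < 1. *)

theory Submission
  imports Defs
begin

text \<open>Induction on the upper index: monotonicity puts \<open>p n\<close> between
  \<open>p m\<close> and \<open>p (Suc n)\<close>, so the last piece can be split off.\<close>

lemma integral_sum_partition:
  fixes f :: "real \<Rightarrow> 'a::banach" and p :: "nat \<Rightarrow> real"
  assumes "m \<le> n" and "mono_on {m..n} p" and "f integrable_on {p m..p n}"
  shows "integral {p m..p n} f = (\<Sum>i = m..<n. integral {p i..p (Suc i)} f)"
  using assms
proof (induction n rule: dec_induct)
  case base
  then show ?case by simp
next
  case (step n)
  have le: "p m \<le> p n" "p n \<le> p (Suc n)"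
    using step.hyps monotone_onD[OF step.prems(1), of m n] monotone_onD[OF step.prems(1), of n "Suc n"]
    by auto
  have "f integrable_on {p m..p n}"
    using step.prems(2) by (rule integrable_subinterval_real) (use le in auto)
  moreover have "mono_on {m..n} p"
    using step.prems(1) by (rule monotone_on_subset) auto
  ultimately have "integral {p m..p n} f = (\<Sum>i = m..<n. integral {p i..p (Suc i)} f)"
    using step.IH by blast
  then show ?case
    using step.hyps Henstock_Kurzweil_Integration.integral_combine[OF le step.prems(2)] by simp
qed

text \<open>Substitution with constant derivative \<open>a\<close>; since \<open>a > 0\<close>, the
  map keeps the order of the endpoints and sends \<open>{l..u}\<close> into the interval on the
  left.\<close>

lemma integral_affine_image:
  fixes f :: "real \<Rightarrow> real"
  assumes "a > 0" and "l \<le> u" and "continuous_on {a * l + b..a * u + b} f"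
  shows "integral {a * l + b..a * u + b} f = a * integral {l..u} (\<lambda>x. f (a * x + b))"
proof -
  have "((\<lambda>x. a *\<^sub>R f (a * x + b)) has_integral
      integral {a * l + b..a * u + b} f) {l..u}"
    by (rule has_integral_substitution[where g = "\<lambda>x. a * x + b" and c = "a * l + b" and d = "a * u + b"])
      (use assms in \<open>auto intro!: derivative_eq_intros\<close>)
  from integral_unique[OF this] show ?thesis
    by simp
qed

text \<open>The function \<open>g\<close> enters only through its values at fixed nodes, so this is
  a polynomial in the argument. It serves to make the Bernstein term integrable.\<close>

lemma continuous_on_bernstein_poly:
  "continuous_on A (bernstein_poly m l u g)"
  unfolding bernstein_poly_def[abs_def] by (intro continuous_intros)

theorem mainTheorem4:
  fixes N m :: nat and p q \<alpha> a b :: "nat \<Rightarrow> real"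
    and S :: "nat \<Rightarrow> real \<Rightarrow> real" and g \<psi> :: "real \<Rightarrow> real"
  assumes "N \<ge> 3" and "strict_mono_on {1..N} p" and "m \<ge> 1"
    and "\<And>i. i \<in> {1..N-1} \<Longrightarrow> \<alpha> i \<in> {-1<..<1}"
    and "pl_interpolant N p q g"
    and "\<And>i x. i \<in> {1..N-1} \<Longrightarrow> S i x = a i * x + b i"
    and "\<And>i. i \<in> {1..N-1} \<Longrightarrow> S i (p 1) = p i"
    and "\<And>i. i \<in> {1..N-1} \<Longrightarrow> S i (p N) = p (i + 1)"
    and "bernstein_fif N p q S \<alpha> m g \<psi>"
  shows "integral {p 1..p N} \<psi> =
    ((\<Sum>i = 1..N-1. a i * integral {p 1..p N} (\<lambda>x. g (S i x)))
      - (\<Sum>i = 1..N-1. \<alpha> i * a i * integral {p 1..p N} (bernstein_poly m (p 1) (p N) g)))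
    / (1 - (\<Sum>i = 1..N-1. \<alpha> i * a i))"
proof -
  let ?I = "{p 1..p N}" and ?B = "bernstein_poly m (p 1) (p N) g"
  have pless: "p i < p j" if "1 \<le> i" "i < j" "j \<le> N" for i j
    using assms(2) that by (auto simp: strict_mono_on_def)
  have mono: "mono_on {1..N} p"
    by (rule strict_mono_on_imp_mono_on[OF assms(2)])
  have p1N: "p 1 < p N" using pless assms(1) by simp
  have contg: "continuous_on ?I g"
    using assms(5) by (simp add: pl_interpolant_def)
  have cont\<psi>: "continuous_on ?I \<psi>"
    using assms(9) by (simp add: bernstein_fif_def)
  have end1: "a i * p 1 + b i = p i" and end2: "a i * p N + b i = p (Suc i)"
    if "i \<in> {1..N-1}" for i
    using assms(6)[OF that] assms(7,8)[OF that] by auto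
  \<comment> \<open>The slope \<open>a i\<close> is the ratio of the length of the i-th piece to
    that of the whole interval.\<close>
  have apos: "a i > 0" if i: "i \<in> {1..N-1}" for i
  proof -
    have "a i * (p N - p 1) = p (Suc i) - p i"
      using end1[OF i] end2[OF i] by (simp add: algebra_simps)
    moreover have "p i < p (Suc i)" using pless i by auto
    ultimately have "0 < a i * (p N - p 1)" by simp
    then show ?thesis using p1N by (simp add: zero_less_mult_iff)
  qed
  have S_sub: "{p i..p (Suc i)} \<subseteq> ?I" if i: "i \<in> {1..N-1}" for i
    using i monotone_onD[OF mono, of 1 i] monotone_onD[OF mono, of "Suc i" N] by auto
  have S_mem: "S i x \<in> {p i..p (Suc i)}" if i: "i \<in> {1..N-1}" and x: "x \<in> ?I" for i x
  proof -
    have "a i * p 1 \<le> a i * x" "a i * x \<le> a i * p N"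
      using apos[OF i] x by auto
    then show ?thesis
      using end1[OF i] end2[OF i] assms(6)[OF i, of x] by auto
  qed
  \<comment> \<open>A nonzero slope makes \<open>S i\<close> injective on the whole line, so
    \<open>inv\<close> really undoes it.\<close>
  have S_inv: "inv (S i) (S i x) = x" if i: "i \<in> {1..N-1}" for i x
    by (rule inv_f_f) (use apos[OF i] assms(6)[OF i] in \<open>auto intro!: injI\<close>)
  have cont_gS: "continuous_on ?I (\<lambda>x. g (S i x))" if i: "i \<in> {1..N-1}" for i
  proof (rule continuous_on_compose2[OF contg])
    show "continuous_on ?I (S i)"
      unfolding ext[of "S i", OF assms(6)[OF i]] by (intro continuous_intros)
    show "S i ` ?I \<subseteq> ?I" using S_mem[OF i] S_sub[OF i] by blast
  qed
  have piece: "integral {p i..p (Suc i)} f = a i * integral ?I (\<lambda>x. f (S i x))"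
    if "continuous_on ?I f" and i: "i \<in> {1..N-1}" for f i
  proof -
    have "continuous_on {p i..p (Suc i)} f"
      using that(1) S_sub[OF i] by (rule continuous_on_subset)
    then show ?thesis
      using integral_affine_image[OF apos[OF i] less_imp_le[OF p1N], where b = "b i" and f = f]
      \<comment> \<open>Without the deletion, \<open>p 1\<close> would turn into
        \<open>p (Suc 0)\<close> and \<open>end1\<close> would no longer match.\<close>
      by (simp add: end1[OF i] end2[OF i] assms(6)[OF i] del: One_nat_def)
  qed
  have idx: "{1..<N} = {1..N-1}" using assms(1) by auto
  have piece_\<psi>: "integral {p i..p (Suc i)} \<psi> =
      a i * integral ?I (\<lambda>x. g (S i x)) - \<alpha> i * a i * integral ?I ?B
      + \<alpha> i * a i * integral ?I \<psi>" if i: "i \<in> {1..N-1}" for i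
  proof -
    \<comment> \<open>The self-referential equation is evaluated at the point \<open>S i x\<close>
      of the i-th piece, where the inverse cancels.\<close>
    have eq: "\<psi> (S i x) = \<alpha> i * \<psi> x + g (S i x) - \<alpha> i * ?B x" if "x \<in> ?I" for x
      using assms(9) i S_mem[OF i that] S_inv[OF i] by (simp add: bernstein_fif_def)
    have int: "\<psi> integrable_on ?I" "?B integrable_on ?I" "(\<lambda>x. g (S i x)) integrable_on ?I"
      by (intro integrable_continuous_real cont\<psi> continuous_on_bernstein_poly cont_gS[OF i])+
    have "integral ?I (\<lambda>x. \<psi> (S i x)) =
        integral ?I (\<lambda>x. \<alpha> i * \<psi> x + g (S i x) - \<alpha> i * ?B x)"
      by (rule integral_cong) (rule eq)
    also have "\<dots> = \<alpha> i * integral ?I \<psi> + integral ?I (\<lambda>x. g (S i x)) - \<alpha> i * integral ?I ?B"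
      using int by (simp add: integral_diff integral_add integrable_add integrable_on_mult_right)
    finally have "a i * integral ?I (\<lambda>x. \<psi> (S i x)) = a i * \<dots>" by (rule arg_cong)
    then show ?thesis
      unfolding piece[OF cont\<psi> i] by (simp only: algebra_simps)
  qed
  have "integral ?I \<psi> = (\<Sum>i = 1..N-1. integral {p i..p (Suc i)} \<psi>)"
    using integral_sum_partition[OF _ mono integrable_continuous_real[OF cont\<psi>]] assms(1)
    unfolding idx by linarith
  also have "\<dots> = (\<Sum>i = 1..N-1. a i * integral ?I (\<lambda>x. g (S i x)))
      - (\<Sum>i = 1..N-1. \<alpha> i * a i * integral ?I ?B) + (\<Sum>i = 1..N-1. \<alpha> i * a i) * integral ?I \<psi>"
    by (simp add: piece_\<psi> sum.distrib sum_subtractf sum_distrib_right del: One_nat_def)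
  \<comment> \<open>The unknown integral occurs on both sides and is collected on the left.\<close>
  finally have main: "(1 - (\<Sum>i = 1..N-1. \<alpha> i * a i)) * integral ?I \<psi> =
      (\<Sum>i = 1..N-1. a i * integral ?I (\<lambda>x. g (S i x)))
      - (\<Sum>i = 1..N-1. \<alpha> i * a i * integral ?I ?B)"
    unfolding left_diff_distrib by linarith
  \<comment> \<open>The lengths of the pieces telescope to \<open>p N - p 1\<close>, which forces
    the slopes to sum to 1.\<close>
  have "(\<Sum>i = 1..N-1. a i) * (p N - p 1) = (\<Sum>i = 1..<N. p (Suc i) - p i)"
    unfolding idx sum_distrib_right
  proof (rule sum.cong[OF refl])
    fix i assume "i \<in> {1..N-1}"
    then show "a i * (p N - p 1) = p (Suc i) - p i"
      using end1[of i] end2[of i] by (simp add: algebra_simps)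
  qed
  also have "\<dots> = p N - p 1" using assms(1) by (simp add: sum_Suc_diff')
  finally have sum_a: "(\<Sum>i = 1..N-1. a i) = 1" using p1N by simp
  \<comment> \<open>Each term is strictly smaller because \<alpha> i < 1 and \<open>a i > 0\<close>,
    and the index set is nonempty by the bound on \<open>N\<close>. As the right side is 1, the
    denominator is nonzero.\<close>
  have "(\<Sum>i = 1..N-1. \<alpha> i * a i) < (\<Sum>i = 1..N-1. a i)"
    by (rule sum_strict_mono) (use assms(1,4) apos in \<open>auto simp: mult_less_cancel_right1\<close>)
  then have "1 - (\<Sum>i = 1..N-1. \<alpha> i * a i) \<noteq> 0"
    unfolding sum_a by linarith
  then show ?thesis
    unfolding main[symmetric] by (rule nonzero_mult_div_cancel_left[symmetric])
qed

end
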